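(* Let $n$ and $a \ge 1$ be integers and $1 < k_1 < k_2 < \cdots < k_a < n$. Let $G = T(n,\{k_1,\ldots,k_a\})$ and $t(v_i) = t(G, v_i, v_n)$, and set $k_0 = 1$. Then for $0 \le s \le a-1$ and $k_s \le i \le k_{s+1}$, \[ t(v_i) = n^2 - i^2 + 2(a-1)n - 2(s-1)i - 2\sum_{j=s+1}^{a} k_j, \] and for $k_a \le i \le n-1$, \[ t(v_i) = n^2 - i^2 + 2(a-1)(n-i). \]
   Context: $T(n,\{k_1,\ldots,k_a\})$ is the tree consisting of a path (spine) $v_1 v_2 \cdots v_n$ together with leaves $u_{k_1},\ldots,u_{k_a}$, where $u_{k_i}$ is adjacent only to $v_{k_i}$. $t(G,v,u)$ denotes the expected number of steps until a simple random walk on $G$ started at $v$ (moving each step to a uniformly random neighbor) first reaches $u$. *)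

theory Defs
  imports "HOL-Probability.Probability" "Graph_Theory.Pair_Digraph"
begin

text \<open>
  \<open>Spine i\<close> and \<open>Leaf k\<close> stand for the vertices $v_i$ and $u_k$ of the tree $T(n, K)$.
  Undirected graphs are represented as symmetric digraphs.
\<close>

datatype vertex = Spine nat | Leaf nat

definition caterpillar_edges :: "nat \<Rightarrow> nat set \<Rightarrow> vertex rel" where
  "caterpillar_edges n K =
     {(Spine i, Spine (i + 1)) | i. 1 \<le> i \<and> i < n} \<union> {(Leaf k, Spine k) | k. k \<in> K}"

definition caterpillar :: "nat \<Rightarrow> nat set \<Rightarrow> vertex pair_pre_digraph" where
  "caterpillar n K =
     \<lparr> pverts = Spine ` {1..n} \<union> Leaf ` K,
       parcs = caterpillar_edges n K \<union> (caterpillar_edges n K)\<inverse> \<rparr>"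

lemma pair_graph_caterpillar:
  assumes "K \<subseteq> {1..n}"
  shows "pair_graph (caterpillar n K)"
proof -
  have fin: "finite K"
    using assms by (rule finite_subset) simp
  have "caterpillar_edges n K \<subseteq> pverts (caterpillar n K) \<times> pverts (caterpillar n K)"
    using assms by (auto simp: caterpillar_edges_def caterpillar_def image_iff)
  then have wf: "parcs (caterpillar n K) \<subseteq> pverts (caterpillar n K) \<times> pverts (caterpillar n K)"
    by (auto simp: caterpillar_def)
  have finv: "finite (pverts (caterpillar n K))"
    using fin by (simp add: caterpillar_def)
  show ?thesis
  proof
    show "finite (parcs (caterpillar n K))"
      using wf finv by (meson finite_SigmaI finite_subset)
    show "symmetric (with_proj (caterpillar n K))"
      by (auto simp: symmetric_def caterpillar_def sym_def)
  qed (use wf finv in \<open>auto simp: caterpillar_def caterpillar_edges_def\<close>)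
qed

definition neighbours :: "'v pair_pre_digraph \<Rightarrow> 'v \<Rightarrow> 'v set" where
  "neighbours G x = {y. x \<rightarrow>\<^bsub>with_proj G\<^esub> y}"

text \<open>
  The distribution of the position at time \<open>m\<close>, given the positions at times \<open>0, ..., m - 1\<close>.
  It is meaningful only if the neighbourhood of the current vertex is finite and nonempty,
  since \<^const>\<open>pmf_of_set\<close> is unspecified otherwise.
\<close>

definition walk_kernel :: "'v pair_pre_digraph \<Rightarrow> 'v \<Rightarrow> nat \<Rightarrow> (nat \<Rightarrow> 'v) \<Rightarrow> 'v measure" where
  "walk_kernel G v m \<omega> =
     measure_pmf (case m of 0 \<Rightarrow> return_pmf v | Suc j \<Rightarrow> pmf_of_set (neighbours G (\<omega> j)))"

interpretation walk: Ionescu_Tulcea "walk_kernel G v" "\<lambda>_. count_space UNIV"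
  for G :: "'v pair_pre_digraph" and v :: 'v
proof (rule Ionescu_Tulcea.intro)
  fix m
  show "walk_kernel G v m \<in> PiM {0..<m} (\<lambda>_. count_space UNIV) \<rightarrow>\<^sub>M subprob_algebra (count_space UNIV)"
  proof (cases m)
    case 0
    then show ?thesis
      by (simp add: walk_kernel_def[abs_def] measure_pmf_in_subprob_algebra)
  next
    case (Suc j)
    have "(\<lambda>\<omega>. \<omega> j) \<in> PiM {0..<m} (\<lambda>_. count_space UNIV) \<rightarrow>\<^sub>M count_space (UNIV :: 'v set)"
      using Suc by (intro measurable_component_singleton) simp
    then have "(\<lambda>\<omega>. measure_pmf (pmf_of_set (neighbours G (\<omega> j)))) \<in>
        PiM {0..<m} (\<lambda>_. count_space UNIV) \<rightarrow>\<^sub>M subprob_algebra (count_space UNIV)"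
      by (rule measurable_compose) (simp add: measure_pmf_in_subprob_algebra)
    with Suc show ?thesis
      by (simp add: walk_kernel_def[abs_def])
  qed
next
  fix m \<omega>
  show "prob_space (walk_kernel G v m \<omega>)"
    unfolding walk_kernel_def by (rule measure_pmf.prob_space_axioms)
qed

text \<open>
  The measure on trajectories given by the Ionescu-Tulcea theorem; its finite-dimensional
  marginals are computed in \<open>emeasure_random_walk_cylinder\<close> below.
\<close>

definition random_walk :: "'v pair_pre_digraph \<Rightarrow> 'v \<Rightarrow> (nat \<Rightarrow> 'v) measure" where
  "random_walk G v = walk.PF.lim G v"

text \<open>The value is \<^term>\<open>\<infinity>\<close> if the trajectory never visits \<open>u\<close>.\<close>

definition hitting_time :: "'v \<Rightarrow> (nat \<Rightarrow> 'v) \<Rightarrow> enat" where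
  "hitting_time u \<omega> = (INF m \<in> {m. \<omega> m = u}. enat m)"

definition expected_hitting_time :: "'v pair_pre_digraph \<Rightarrow> 'v \<Rightarrow> 'v \<Rightarrow> ennreal" where
  "expected_hitting_time G v u =
     (\<integral>\<^sup>+ \<omega>. ennreal_of_enat (hitting_time u \<omega>) \<partial>random_walk G v)"

lemma sets_random_walk [measurable_cong]:
  "sets (random_walk G v) = sets (PiM UNIV (\<lambda>_. count_space UNIV))"
  by (simp add: random_walk_def)

lemma emeasure_random_walk_emb:
  assumes "X \<in> sets (PiM {0..<m} (\<lambda>_. count_space UNIV))"
  shows "emeasure (random_walk G v) (prod_emb UNIV (\<lambda>_. count_space UNIV) {0..<m} X) =
    emeasure (walk.C G v 0 m (\<lambda>_. undefined)) X"
  using walk.lim[of "{0..<m}" X G v] walk.emeasure_CI[of "{0..<m}" m X G v] assms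
    sets.sets_into_space[OF assms]
  by (simp add: random_walk_def prod_emb_id space_PiM)

lemma prob_space_random_walk: "prob_space (random_walk G v)"
proof
  interpret C: prob_space "walk.C G v 0 0 (\<lambda>_. undefined)"
    by (rule walk.prob_space_C) (simp add: space_PiM)
  have "prod_emb UNIV (\<lambda>_. count_space UNIV) {0..<0} (space (PiM {0..<0} (\<lambda>_. count_space UNIV)))
      = (UNIV :: (nat \<Rightarrow> 'a) set)"
    by (auto simp: prod_emb_def space_PiM)
  then show "emeasure (random_walk G v) (space (random_walk G v)) = 1"
    using emeasure_random_walk_emb[OF sets.top, of G v 0] C.emeasure_space_1
    by (simp add: random_walk_def space_PiM PiE_UNIV_domain)
qed

lemma emeasure_walk_C:
  "emeasure (walk.C G v 0 m (\<lambda>_. undefined)) (PiE {0..<m} (\<lambda>i. {x i})) =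
     (\<Prod>i<m. emeasure (walk_kernel G v i x) {x i})"
proof (induction m)
  case 0
  have "(\<lambda>_. undefined) \<in> space (PiM {} (\<lambda>_. count_space UNIV))"
    by (simp add: space_PiM)
  then show ?case
    by (simp add: emeasure_return PiE_empty_domain sets_PiM_empty)
next
  case (Suc m)
  let ?M = "\<lambda>J. PiM J (\<lambda>_. count_space UNIV) :: (nat \<Rightarrow> 'a) measure"
  let ?C = "walk.C G v 0 m (\<lambda>_. undefined)"
  let ?A = "\<lambda>m. PiE {0..<m} (\<lambda>i. {x i})"
  have A: "?A k \<in> sets (?M {0..<k})" for k
    by (rule sets_PiM_I_finite) auto
  have und: "(\<lambda>_. undefined) \<in> space (?M {0..<0})"
    by (simp add: space_PiM)
  have spC: "space ?C = space (?M {0..<m})"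
    using walk.space_C[OF und, of G v m] by simp
  have setC: "sets ?C = sets (?M {0..<m})"
    using walk.sets_C[OF und, of G v m] by simp
  have eP: "emeasure (walk.eP G v m \<omega>) (?A (Suc m)) =
      emeasure (walk_kernel G v m x) {x m} * indicator (?A m) \<omega>"
    if \<omega>: "\<omega> \<in> space (?M {0..<m})" for \<omega>
  proof -
    have "(\<lambda>y. fun_upd \<omega> m y) -` ?A (Suc m) = (if \<omega> \<in> ?A m then {x m} else {})"
      using \<omega> by (auto simp: space_PiM PiE_iff extensional_def less_Suc_eq all_conj_distrib
          ball_conj_distrib atLeastLessThanSuc)
    moreover have "walk_kernel G v m \<omega> = walk_kernel G v m x" if "\<omega> \<in> ?A m"
      using that by (cases m) (auto simp: walk_kernel_def PiE_iff)
    ultimately show ?thesis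
      using walk.emeasure_eP[OF \<omega> A[of "Suc m"], of G v] by auto
  qed
  have "emeasure (walk.C G v 0 (Suc m) (\<lambda>_. undefined)) (?A (Suc m)) =
      (\<integral>\<^sup>+\<omega>. emeasure (walk.eP G v m \<omega>) (?A (Suc m)) \<partial>?C)"
  proof -
    have "space ?C \<noteq> {}"
      unfolding spC by simp
    moreover have "walk.eP G v m \<in> ?C \<rightarrow>\<^sub>M subprob_algebra (?M {0..<Suc m})"
      using walk.measurable_eP[of G v m] by (simp add: measurable_cong_sets[OF setC refl])
    ultimately show ?thesis
      using emeasure_bind[OF _ _ A[of "Suc m"], of ?C "walk.eP G v m"] by simp
  qed
  also have "\<dots> = (\<integral>\<^sup>+\<omega>. emeasure (walk_kernel G v m x) {x m} * indicator (?A m) \<omega> \<partial>?C)"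
    by (intro nn_integral_cong eP) (simp add: spC)
  also have "\<dots> = emeasure (walk_kernel G v m x) {x m} * emeasure ?C (?A m)"
    using A[of m] by (intro nn_integral_cmult_indicator) (simp only: setC)
  finally show ?case
    by (simp add: Suc.IH mult.commute)
qed

lemma emeasure_random_walk_cylinder:
  "emeasure (random_walk G v) {\<omega>. \<forall>i\<le>m. \<omega> i = x i} =
     ennreal (of_bool (x 0 = v) * (\<Prod>i<m. pmf (pmf_of_set (neighbours G (x i))) (x (Suc i))))"
proof -
  have "{\<omega>. \<forall>i\<le>m. \<omega> i = x i} =
      prod_emb UNIV (\<lambda>_. count_space UNIV) {0..<Suc m} (PiE {0..<Suc m} (\<lambda>i. {x i}))"
    by (auto simp: prod_emb_def PiE_iff)
  then have "emeasure (random_walk G v) {\<omega>. \<forall>i\<le>m. \<omega> i = x i} =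
      (\<Prod>i<Suc m. emeasure (walk_kernel G v i x) {x i})"
    using emeasure_random_walk_emb[OF sets_PiM_I_finite, of "Suc m" "\<lambda>i. {x i}" G v]
    by (simp add: emeasure_walk_C del: prod.lessThan_Suc walk.C.simps)
  also have "\<dots> = ennreal (of_bool (x 0 = v)) *
      (\<Prod>i<m. ennreal (pmf (pmf_of_set (neighbours G (x i))) (x (Suc i))))"
    by (simp add: prod.lessThan_Suc_shift walk_kernel_def emeasure_pmf_single indicator_def
        del: prod.lessThan_Suc)
  finally show ?thesis
    by (simp add: prod_ennreal ennreal_mult prod_nonneg)
qed

lemma measurable_hitting_time [measurable]:
  "hitting_time u \<in> random_walk G v \<rightarrow>\<^sub>M count_space UNIV"
proof -
  have "hitting_time u \<omega> = (INF m. if \<omega> m = u then enat m else \<infinity>)" for \<omega>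
    unfolding hitting_time_def
  proof (intro antisym INF_greatest)
    fix m assume "m \<in> {m. \<omega> m = u}"
    then show "(INF m. if \<omega> m = u then enat m else \<infinity>) \<le> enat m"
      by (intro INF_lower2[of m]) auto
  qed (auto intro: INF_lower)
  then have "hitting_time u = (\<lambda>\<omega>. INF m. if \<omega> m = u then enat m else \<infinity>)"
    by (rule ext)
  moreover have "(\<lambda>\<omega>. if \<omega> m = u then enat m else \<infinity>) \<in> random_walk G v \<rightarrow>\<^sub>M count_space UNIV" for m
  proof -
    have "(\<lambda>\<omega>. \<omega> m) \<in> random_walk G v \<rightarrow>\<^sub>M count_space UNIV"
      by (simp add: measurable_cong_sets[OF sets_random_walk refl] measurable_component_singleton)
    then show ?thesis
      by (rule measurable_compose) simp
  qed
  ultimately show ?thesis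
    by (simp only: measurable_INF countableI_type)
qed

end

theory Submission
  imports Defs
begin

text \<open>
  If \<open>h\<close> vanishes at the target \<open>u\<close> and \<open>h x\<close> is one more than the average of \<open>h\<close> over the
  neighbours of every other \<open>x\<close>, then telescoping along the walk \<open>\<omega>\<close>, with hitting time \<open>T\<close>, gives
  \<open>h v = (\<Sum>m<M. P(T > m)) + E[h(\<omega>\<^sub>M); T > M]\<close>. The tail sums are thus bounded, so \<open>P(T > M)\<close>
  tends to \<open>0\<close>; for bounded \<open>h\<close> the remainder vanishes and \<open>h v = E T\<close>. On the caterpillar, \<open>h\<close> is
  found by adding up the expected times to cross the successive spine edges towards the target.
\<close>

section \<open>Integration along the walk: finite histories, the Markov property,
  confinement\<close>

abbreviation histories :: "nat \<Rightarrow> (nat \<Rightarrow> 'v) measure" where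
  "histories m \<equiv> PiM {0..<m} (\<lambda>_. count_space UNIV)"

text \<open>Restriction to the first \<open>m\<close> coordinates pushes the trajectory measure
  forward to \<open>walk.C\<close>, because the preimages of measurable sets under it are exactly
  the cylinders of \<open>emeasure_random_walk_emb\<close>. Integrals over trajectories can then be
  computed from the recursive construction.\<close>

lemma nn_integral_random_walk:
  assumes F: "F \<in> borel_measurable (histories m)"
  shows "(\<integral>\<^sup>+\<omega>. F (restrict \<omega> {0..<m}) \<partial>random_walk G v) =
    (\<integral>\<^sup>+\<omega>. F \<omega> \<partial>walk.C G v 0 m (\<lambda>_. undefined))"
proof -
  let ?C = "walk.C G v 0 m (\<lambda>_. undefined)"
  have und: "(\<lambda>_. undefined) \<in> space (histories 0)"
    by (simp add: space_PiM)
  have setC: "sets ?C = sets (histories m)"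
    using walk.sets_C[OF und, of G v m] by simp
  have meas: "(\<lambda>\<omega>. restrict \<omega> {0..<m}) \<in> random_walk G v \<rightarrow>\<^sub>M histories m"
    by (subst measurable_cong_sets[OF sets_random_walk refl]) (rule measurable_restrict_subset, simp)
  have "?C = distr (random_walk G v) (histories m) (\<lambda>\<omega>. restrict \<omega> {0..<m})"
  proof (rule measure_eqI)
    fix X assume "X \<in> sets ?C"
    then have X: "X \<in> sets (histories m)" by (simp add: setC)
    have "(\<lambda>\<omega>. restrict \<omega> {0..<m}) -` X \<inter> space (random_walk G v) =
        prod_emb UNIV (\<lambda>_. count_space UNIV) {0..<m} X"
      using sets_eq_imp_space_eq[OF sets_random_walk[of G v]] by (simp add: prod_emb_def space_PiM)
    then show "emeasure ?C X =
        emeasure (distr (random_walk G v) (histories m) (\<lambda>\<omega>. restrict \<omega> {0..<m})) X"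
      by (simp add: emeasure_distr[OF meas X] emeasure_random_walk_emb[OF X])
  qed (simp add: setC)
  then show ?thesis
    using F by (simp add: nn_integral_distr[OF meas])
qed

text \<open>This is the Markov property at a fixed time, with \<open>g\<close> as an arbitrary
  weight on the past. The law of a longer history is that of the shorter one followed by one step of
  \<open>walk.eP\<close>, and the kernel of that step looks only at the latest position.\<close>

lemma random_walk_markov:
  fixes f :: "'v \<Rightarrow> ennreal"
  assumes g[measurable]: "g \<in> borel_measurable (histories (Suc m))"
  shows "(\<integral>\<^sup>+\<omega>. g (restrict \<omega> {0..<Suc m}) * f (\<omega> (Suc m)) \<partial>random_walk G v) =
    (\<integral>\<^sup>+\<omega>. g (restrict \<omega> {0..<Suc m}) *
      (\<integral>\<^sup>+y. f y \<partial>measure_pmf (pmf_of_set (neighbours G (\<omega> m)))) \<partial>random_walk G v)"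
proof -
  let ?C = "\<lambda>m. walk.C G v 0 m (\<lambda>_. undefined)"
  let ?K = "\<lambda>x. \<integral>\<^sup>+y. f y \<partial>measure_pmf (pmf_of_set (neighbours G x))"
  define F where "F \<omega> = g (restrict \<omega> {0..<Suc m}) * f (\<omega> (Suc m))" for \<omega> :: "nat \<Rightarrow> 'v"
  have und: "(\<lambda>_. undefined) \<in> space (histories 0)"
    by (simp add: space_PiM)
  have spC: "space (?C k) = space (histories k)" for k
    using walk.space_C[OF und, of G v k] by simp
  have setC: "sets (?C k) = sets (histories k)" for k
    using walk.sets_C[OF und, of G v k] by simp
  have coord: "(\<lambda>\<omega>. h (\<omega> i)) \<in> borel_measurable (histories k)" if "i < k"
    for h :: "'v \<Rightarrow> ennreal" and i k
    using that by (intro measurable_compose[OF measurable_component_singleton]) auto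
  have g': "(\<lambda>\<omega>. g (restrict \<omega> {0..<Suc m})) \<in> borel_measurable (histories (Suc (Suc m)))"
    by (rule measurable_compose[OF measurable_restrict_subset g]) simp
  have F: "F \<in> borel_measurable (histories (Suc (Suc m)))"
    unfolding F_def using g' coord[of "Suc m" "Suc (Suc m)" f] by (rule borel_measurable_times_ennreal) simp
  have eP: "walk.eP G v (Suc m) \<in> ?C (Suc m) \<rightarrow>\<^sub>M subprob_algebra (histories (Suc (Suc m)))"
    using walk.measurable_eP[of G v "Suc m"] by (simp add: measurable_cong_sets[OF setC refl] del: walk.C.simps)
  have "(\<integral>\<^sup>+\<omega>. g (restrict \<omega> {0..<Suc m}) * f (\<omega> (Suc m)) \<partial>random_walk G v) =
      (\<integral>\<^sup>+\<omega>. F \<omega> \<partial>?C (Suc (Suc m)))"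
    unfolding nn_integral_random_walk[OF F, symmetric] by (simp add: F_def min_def)
  also have "\<dots> = (\<integral>\<^sup>+\<omega>. \<integral>\<^sup>+\<omega>'. F \<omega>' \<partial>walk.eP G v (Suc m) \<omega> \<partial>?C (Suc m))"
    using nn_integral_bind[OF F eP] by simp
  also have "\<dots> = (\<integral>\<^sup>+\<omega>. g \<omega> * ?K (\<omega> m) \<partial>?C (Suc m))"
  proof (rule nn_integral_cong)
    fix \<omega> assume "\<omega> \<in> space (?C (Suc m))"
    then have \<omega>: "\<omega> \<in> space (histories (Suc m))"
      by (simp only: spC)
    \<comment> \<open>The new position is invisible to the restriction, so \<open>g\<close> is
      constant in the inner integral and factors out.\<close>
    then have res: "restrict (fun_upd \<omega> (Suc m) y) {0..<Suc m} = \<omega>" for y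
      by (auto simp: space_PiM PiE_iff extensional_def fun_eq_iff)
    show "(\<integral>\<^sup>+\<omega>'. F \<omega>' \<partial>walk.eP G v (Suc m) \<omega>) = g \<omega> * ?K (\<omega> m)"
      unfolding walk.nn_integral_eP[OF \<omega> F]
      by (simp add: F_def res walk_kernel_def nn_integral_cmult)
  qed
  also have "\<dots> = (\<integral>\<^sup>+\<omega>. g (restrict \<omega> {0..<Suc m}) * ?K (restrict \<omega> {0..<Suc m} m) \<partial>random_walk G v)"
    by (rule nn_integral_random_walk[symmetric]) (intro borel_measurable_times_ennreal g coord, simp)
  finally show ?thesis by simp
qed

lemma measurable_random_walk_coord:
  "(\<lambda>\<omega>. h (\<omega> i)) \<in> borel_measurable (random_walk G v)" for h :: "'v \<Rightarrow> ennreal"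
  by (subst measurable_cong_sets[OF sets_random_walk refl])
    (rule measurable_compose[OF measurable_component_singleton], auto)

lemma nn_integral_random_walk_0:
  "(\<integral>\<^sup>+\<omega>. f (\<omega> 0) \<partial>random_walk G v) = f v" for f :: "'v \<Rightarrow> ennreal"
proof -
  have F: "(\<lambda>\<omega>. f (\<omega> 0)) \<in> borel_measurable (histories 1)"
    by (rule measurable_compose[OF measurable_component_singleton]) auto
  have und: "(\<lambda>_. undefined) \<in> space (histories 0)"
    by (simp add: space_PiM)
  have "(\<integral>\<^sup>+\<omega>. f (\<omega> 0) \<partial>random_walk G v) = (\<integral>\<^sup>+\<omega>. f (\<omega> 0) \<partial>walk.C G v 0 1 (\<lambda>_. undefined))"
    using nn_integral_random_walk[OF F] by simp
  also have "\<dots> = (\<integral>\<^sup>+\<omega>. f (\<omega> 0) \<partial>walk.eP G v 0 (\<lambda>_. undefined))"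
    using bind_return[OF walk.measurable_eP[of G v 0] und] by simp
  also have "\<dots> = f v"
    using walk.nn_integral_eP[OF und, of "\<lambda>\<omega>. f (\<omega> 0)" G v] F by (simp add: walk_kernel_def)
  finally show ?thesis .
qed

text \<open>By the Markov property with weight 1, the probability of being outside \<open>S\<close>
  cannot increase in one step, and it is 0 at the start.\<close>

lemma AE_random_walk_in:
  assumes v: "v \<in> S"
    and S: "\<And>x. x \<in> S \<Longrightarrow> finite (neighbours G x) \<and> neighbours G x \<noteq> {} \<and> neighbours G x \<subseteq> S"
  shows "AE \<omega> in random_walk G v. \<omega> i \<in> S"
proof -
  let ?out = "indicator (- S) :: 'a \<Rightarrow> ennreal"
  have "(\<integral>\<^sup>+\<omega>. ?out (\<omega> i) \<partial>random_walk G v) = 0"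
  proof (induction i)
    case 0
    show ?case using v by (simp add: nn_integral_random_walk_0)
  next
    case (Suc m)
    have "(\<integral>\<^sup>+\<omega>. ?out (\<omega> (Suc m)) \<partial>random_walk G v) =
        (\<integral>\<^sup>+\<omega>. (\<integral>\<^sup>+y. ?out y \<partial>measure_pmf (pmf_of_set (neighbours G (\<omega> m)))) \<partial>random_walk G v)"
      using random_walk_markov[where g = "\<lambda>_. 1" and f = ?out and G = G and v = v and m = m] by simp
    also have "\<dots> \<le> (\<integral>\<^sup>+\<omega>. ?out (\<omega> m) \<partial>random_walk G v)"
    proof (rule nn_integral_mono)
      fix \<omega>
      show "(\<integral>\<^sup>+y. ?out y \<partial>measure_pmf (pmf_of_set (neighbours G (\<omega> m)))) \<le> ?out (\<omega> m)"
      proof (cases "\<omega> m \<in> S")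
        case True
        then have "(\<integral>\<^sup>+y. ?out y \<partial>measure_pmf (pmf_of_set (neighbours G (\<omega> m)))) = 0"
          using S by (subst nn_integral_pmf_of_set) (auto simp: indicator_def intro!: sum.neutral)
        then show ?thesis by simp
      next
        case False
        \<comment> \<open>Nothing is known about the neighbourhood here, but
          \<open>pmf_of_set\<close> still yields some probability distribution, and the right-hand
          side is 1.\<close>
        then show ?thesis
          by (simp add: measure_pmf.emeasure_le_1)
      qed
    qed
    finally show ?case using Suc.IH by simp
  qed
  then have "AE \<omega> in random_walk G v. ?out (\<omega> i) = 0"
    by (subst (asm) nn_integral_0_iff_AE) (auto intro: measurable_random_walk_coord)
  then show ?thesis
    by eventually_elim (auto simp: indicator_def split: if_splits)
qed

section \<open>Expected hitting times from one-step equations\<close>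

lemma less_hitting_time_iff: "enat m < hitting_time u \<omega> \<longleftrightarrow> (\<forall>i\<le>m. \<omega> i \<noteq> u)"
proof -
  have "hitting_time u \<omega> \<le> enat m \<longleftrightarrow> (\<exists>i\<le>m. \<omega> i = u)"
  proof
    assume *: "hitting_time u \<omega> \<le> enat m"
    \<comment> \<open>An infimum over the empty set would be infinite; over a nonempty set of
      \<open>enat\<close> it is attained.\<close>
    then obtain t where "t \<in> enat ` {i. \<omega> i = u}"
      unfolding hitting_time_def by (metis Inf_empty enat_ord_code(5) equals0I top_enat_def)
    then have "hitting_time u \<omega> \<in> enat ` {i. \<omega> i = u}"
      unfolding hitting_time_def by (rule wellorder_InfI)
    with * show "\<exists>i\<le>m. \<omega> i = u" by auto
  next
    assume "\<exists>i\<le>m. \<omega> i = u"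
    then show "hitting_time u \<omega> \<le> enat m"
      by (auto simp: hitting_time_def intro: INF_lower2)
  qed
  then show ?thesis by (auto simp: not_le[symmetric])
qed

text \<open>Closure of \<open>S\<close> under steps makes the equations for \<open>h\<close>
  available almost surely at every time, and finiteness of \<open>S\<close> bounds \<open>h\<close>
  along the walk. Nonnegativity lets the whole computation take place in
  \<open>ennreal\<close>.\<close>

lemma expected_hitting_time_eqI:
  fixes G :: "'v pair_pre_digraph" and h :: "'v \<Rightarrow> real"
  assumes "finite S" and v: "v \<in> S"
    and S: "\<And>x. x \<in> S \<Longrightarrow> finite (neighbours G x) \<and> neighbours G x \<noteq> {} \<and> neighbours G x \<subseteq> S"
    and h_nonneg: "\<And>x. x \<in> S \<Longrightarrow> 0 \<le> h x"
    and h_u: "h u = 0"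
    and h_step: "\<And>x. x \<in> S - {u} \<Longrightarrow> h x = 1 + (\<Sum>y\<in>neighbours G x. h y) / card (neighbours G x)"
  shows "expected_hitting_time G v u = ennreal (h v)"
proof -
  let ?W = "random_walk G v"
  \<comment> \<open>\<open>g m\<close> is the indicator of survival past time \<open>m\<close>. The
    product form makes it evident that it is measurable and depends only on positions up to time
    \<open>m\<close>.\<close>
  define g :: "nat \<Rightarrow> (nat \<Rightarrow> 'v) \<Rightarrow> ennreal"
    where "g m \<omega> = (\<Prod>i<Suc m. indicator (- {u}) (\<omega> i))" for m \<omega>
  define p where "p m = (\<integral>\<^sup>+\<omega>. g m \<omega> \<partial>?W)" for m
  define b where "b m = (\<integral>\<^sup>+\<omega>. g m \<omega> * ennreal (h (\<omega> m)) \<partial>?W)" for m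
  have g_eq: "g m \<omega> = indicator {\<omega>. \<forall>i\<le>m. \<omega> i \<noteq> u} \<omega>" for m \<omega>
    by (auto simp: g_def indicator_def less_Suc_eq_le simp del: prod.lessThan_Suc)
  have g_meas[measurable]: "g m \<in> borel_measurable ?W" for m
    unfolding g_def by (intro borel_measurable_prod_ennreal measurable_random_walk_coord)
  have h_meas[measurable]: "(\<lambda>\<omega>. ennreal (h (\<omega> m))) \<in> borel_measurable ?W" for m
    by (rule measurable_random_walk_coord)
  have g_hist: "g m \<in> borel_measurable (histories (Suc m))" for m
    unfolding g_def
    by (intro borel_measurable_prod_ennreal measurable_compose[OF measurable_component_singleton]) auto
  have g_restrict: "g m (restrict \<omega> {0..<Suc m}) = g m \<omega>" for m \<omega>
    unfolding g_def by (intro prod.cong) auto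
  have h_step': "ennreal (h x) =
      1 + (\<integral>\<^sup>+y. ennreal (h y) \<partial>measure_pmf (pmf_of_set (neighbours G x)))"
    if x: "x \<in> S" "x \<noteq> u" for x
  proof -
    let ?N = "neighbours G x"
    have N: "finite ?N" "?N \<noteq> {}" "?N \<subseteq> S" using S x by auto
    have "(\<integral>\<^sup>+y. ennreal (h y) \<partial>measure_pmf (pmf_of_set ?N)) = ennreal ((\<Sum>y\<in>?N. h y) / card ?N)"
      using N h_nonneg
      by (simp add: nn_integral_pmf_of_set sum_ennreal subset_iff divide_ennreal sum_nonneg card_gt_0_iff
          ennreal_of_nat_eq_real_of_nat)
    moreover have "0 \<le> (\<Sum>y\<in>?N. h y) / card ?N"
      using N h_nonneg by (intro divide_nonneg_nonneg sum_nonneg) auto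
    ultimately show ?thesis
      using h_step[of x] x by (simp add: ennreal_plus flip: ennreal_1)
  qed
  have AE_S: "AE \<omega> in ?W. \<omega> m \<in> S" for m
    using v S by (rule AE_random_walk_in)
  have step: "b m = p m + b (Suc m)" for m
  proof -
    have "b m = (\<integral>\<^sup>+\<omega>. g m \<omega> + g m \<omega> *
        (\<integral>\<^sup>+y. ennreal (h y) \<partial>measure_pmf (pmf_of_set (neighbours G (\<omega> m)))) \<partial>?W)"
      unfolding b_def
    proof (rule nn_integral_cong_AE)
      show "AE \<omega> in ?W. g m \<omega> * ennreal (h (\<omega> m)) = g m \<omega> + g m \<omega> *
        (\<integral>\<^sup>+y. ennreal (h y) \<partial>measure_pmf (pmf_of_set (neighbours G (\<omega> m))))"
        using AE_S[of m]
      proof eventually_elim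
        case (elim \<omega>)
        then show ?case
          \<comment> \<open>At \<open>u\<close>, where no step equation is assumed, both sides
            vanish with \<open>g m\<close>.\<close>
          by (cases "\<omega> m = u") (auto simp: g_eq h_step' split: split_indicator)
      qed
    qed
    also have "\<dots> = p m + (\<integral>\<^sup>+\<omega>. g m \<omega> *
        (\<integral>\<^sup>+y. ennreal (h y) \<partial>measure_pmf (pmf_of_set (neighbours G (\<omega> m)))) \<partial>?W)"
      unfolding p_def
      by (intro nn_integral_add g_meas borel_measurable_times_ennreal measurable_random_walk_coord)
    also have "(\<integral>\<^sup>+\<omega>. g m \<omega> *
        (\<integral>\<^sup>+y. ennreal (h y) \<partial>measure_pmf (pmf_of_set (neighbours G (\<omega> m)))) \<partial>?W) =
        (\<integral>\<^sup>+\<omega>. g m \<omega> * ennreal (h (\<omega> (Suc m))) \<partial>?W)"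
      using random_walk_markov[OF g_hist, where f = "\<lambda>x. ennreal (h x)" and G = G and v = v and m = m] by (simp only: g_restrict)
    \<comment> \<open>Since \<open>h u = 0\<close>, the survival factor for time
      \<open>Suc m\<close> can be inserted without changing the integrand.\<close>
    also have "\<dots> = b (Suc m)"
      unfolding b_def
    proof (rule nn_integral_cong)
      show "g m \<omega> * ennreal (h (\<omega> (Suc m))) = g (Suc m) \<omega> * ennreal (h (\<omega> (Suc m)))" for \<omega>
        by (cases "\<omega> (Suc m) = u") (auto simp: g_def h_u)
    qed
    finally show ?thesis .
  qed
  have "b 0 = ennreal (h v)"
  proof -
    have "b 0 = (\<integral>\<^sup>+\<omega>. indicator (- {u}) (\<omega> 0) * ennreal (h (\<omega> 0)) \<partial>?W)"
      by (simp add: b_def g_def)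
    also have "\<dots> = indicator (- {u}) v * ennreal (h v)"
      by (rule nn_integral_random_walk_0)
    also have "\<dots> = ennreal (h v)"
      using h_u by (auto simp: indicator_def)
    finally show ?thesis .
  qed
  then have telescope: "ennreal (h v) = (\<Sum>m<M. p m) + b M" for M
  proof (induction M)
    case (Suc M)
    then show ?case using step[of M] by (simp add: add.assoc)
  qed simp
  define H where "H = Max (h ` S)"
  have b_le: "b m \<le> ennreal H * p m" for m
  proof -
    have "b m \<le> (\<integral>\<^sup>+\<omega>. ennreal H * g m \<omega> \<partial>?W)"
      unfolding b_def
    proof (rule nn_integral_mono_AE)
      show "AE \<omega> in ?W. g m \<omega> * ennreal (h (\<omega> m)) \<le> ennreal H * g m \<omega>"
        using AE_S[of m]
      proof eventually_elim
        case (elim \<omega>)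
        then have "h (\<omega> m) \<le> H" using \<open>finite S\<close> by (simp add: H_def)
        then show ?case
          by (simp add: mult.commute[of "g m \<omega>"] mult_right_mono ennreal_leI)
      qed
    qed
    then show ?thesis by (simp add: p_def nn_integral_cmult)
  qed
  have sums: "(\<lambda>M. \<Sum>m<M. p m) \<longlonglongrightarrow> (\<Sum>m. p m)"
    by (intro summable_LIMSEQ summableI)
  \<comment> \<open>Dropping the nonnegative remainder \<open>b M\<close> from
    \<open>telescope\<close> bounds every partial sum.\<close>
  have "(\<Sum>m. p m) \<le> ennreal (h v)"
    by (intro suminf_le_const summableI) (metis telescope le_iff_add)
  then have fin: "(\<Sum>m. p m) < \<infinity>"
    by (metis ennreal_less_top infinity_ennreal_def order_le_less_trans)
  \<comment> \<open>Every series in \<open>ennreal\<close> is summable, so the finite sum is first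
    carried over to the reals, where summability forces the terms to 0.\<close>
  have p0: "p \<longlonglongrightarrow> 0"
  proof -
    have "p m \<noteq> top" for m
      using sum_le_suminf[OF summableI, of "{m}" p] fin by (auto simp: top_unique)
    then have p_real: "p m = ennreal (enn2real (p m))" for m
      by (simp add: less_top)
    then have "summable (\<lambda>m. enn2real (p m))"
      using fin by (intro summable_suminf_not_top) (auto simp flip: p_real)
    from tendsto_ennrealI[OF summable_LIMSEQ_zero[OF this]] show ?thesis
      by (simp flip: p_real)
  qed
  have "(\<lambda>m. ennreal H * p m) \<longlonglongrightarrow> ennreal H * 0"
    using p0 by (intro ennreal_tendsto_cmult) auto
  then have "b \<longlonglongrightarrow> 0"
    by (intro tendsto_sandwich[OF _ _ tendsto_const, of _ b]) (auto simp: b_le)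
  with sums have "(\<lambda>M. (\<Sum>m<M. p m) + b M) \<longlonglongrightarrow> (\<Sum>m. p m) + 0"
    by (rule tendsto_add)
  then have "ennreal (h v) = (\<Sum>m. p m)"
    by (simp add: LIMSEQ_const_iff flip: telescope)
  \<comment> \<open>The expectation of an \<open>enat\<close>-valued variable is the sum of its tail
    probabilities.\<close>
  moreover have "expected_hitting_time G v u = (\<Sum>m. p m)"
  proof -
    have "p m = emeasure ?W {\<omega> \<in> space ?W. enat m < hitting_time u \<omega>}" for m
    proof -
      have "p m = (\<integral>\<^sup>+\<omega>. indicator {\<omega> \<in> space ?W. enat m < hitting_time u \<omega>} \<omega> \<partial>?W)"
        unfolding p_def by (intro nn_integral_cong) (auto simp: g_eq less_hitting_time_iff indicator_def)
      then show ?thesis by simp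
    qed
    then show ?thesis
      unfolding expected_hitting_time_def by (simp add: nn_integral_enat_function)
  qed
  ultimately show ?thesis by simp
qed

section \<open>The potential on the caterpillar\<close>

lemma neighbours_caterpillar_Leaf:
  "k \<in> K \<Longrightarrow> neighbours (caterpillar n K) (Leaf k) = {Spine k}"
  by (auto simp: neighbours_def caterpillar_def caterpillar_edges_def arcs_ends_conv)

lemma neighbours_caterpillar_Spine:
  "neighbours (caterpillar n K) (Spine i) =
    (if 1 \<le> i \<and> i < n then {Spine (i + 1)} else {}) \<union>
    (if 1 < i \<and> i \<le> n then {Spine (i - 1)} else {}) \<union> (if i \<in> K then {Leaf i} else {})"
  by (auto simp: neighbours_def caterpillar_def caterpillar_edges_def arcs_ends_conv)

text \<open>
  The walk crosses from \<open>Spine m\<close> to \<open>Spine (m + 1)\<close> in expected time \<open>2e + 1\<close>, where \<open>e\<close> is the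
  number of edges on the near side of the crossed edge.
\<close>

definition crossing_time :: "nat set \<Rightarrow> nat \<Rightarrow> real" where
  "crossing_time K m = 2 * (real m - 1 + real (card {k \<in> K. k \<le> m})) + 1"

text \<open>The extra 1 at a leaf is the forced step onto the spine.\<close>

fun potential :: "nat \<Rightarrow> nat set \<Rightarrow> vertex \<Rightarrow> real" where
  "potential n K (Spine i) = (\<Sum>m = i..<n. crossing_time K m)"
| "potential n K (Leaf k) = (\<Sum>m = k..<n. crossing_time K m) + 1"

text \<open>Moving the crossed edge one place on adds a spine edge to the near side, and a leaf edge
  if one hangs there; each edge counts twice.\<close>

lemma crossing_time_Suc:
  assumes "finite K"
  shows "crossing_time K (Suc m) = crossing_time K m + 2 + 2 * of_bool (Suc m \<in> K)"
proof -
  have "{k \<in> K. k \<le> Suc m} = {k \<in> K. k \<le> m} \<union> (if Suc m \<in> K then {Suc m} else {})"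
    by (auto simp: le_Suc_eq)
  then show ?thesis
    using assms by (simp add: crossing_time_def)
qed

text \<open>At an inner spine vertex, the differences of the potential to its neighbours are
  crossing times, and 1 for a leaf. Multiplied by the degree, the equation becomes the recurrence
  \<open>crossing_time_Suc\<close>.\<close>

lemma potential_step:
  assumes K: "K \<subseteq> {1<..<n}" and x: "x \<in> Spine ` {1..n} \<union> Leaf ` K - {Spine n}"
  defines "N \<equiv> neighbours (caterpillar n K) x"
  shows "potential n K x = 1 + (\<Sum>y\<in>N. potential n K y) / card N"
  using x
proof (cases x)
  case (Leaf k)
  then show ?thesis using x by (auto simp: N_def neighbours_caterpillar_Leaf)
next
  case (Spine i)
  have fK: "finite K" using K by (rule finite_subset) simp
  have i: "1 \<le> i" "i < n" using x Spine by auto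
  have up: "potential n K (Spine i) = crossing_time K i + potential n K (Spine (i + 1))"
    using i by (simp add: sum.atLeast_Suc_lessThan)
  show ?thesis
  proof (cases "i = 1")
    case True
    \<comment> \<open>No leaf hangs at the first spine vertex, so its only move is forward and takes
      time 1.\<close>
    have empty: "{k \<in> K. k \<le> Suc 0} = {}" and "1 \<notin> K" using K by auto
    then have "N = {Spine (i + 1)}"
      using True i Spine by (auto simp: N_def neighbours_caterpillar_Spine)
    moreover have "crossing_time K i = 1"
      using True by (simp add: crossing_time_def empty)
    ultimately show ?thesis using up Spine by simp
  next
    case False
    \<comment> \<open>Naming the predecessor removes the truncated subtraction \<open>i - 1\<close>
      from the neighbourhood.\<close>
    then obtain j where j: "i = Suc j" "1 \<le> j" using i by (cases i) auto
    have down: "potential n K (Spine j) = crossing_time K j + potential n K (Spine i)"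
      using i j by (simp add: sum.atLeast_Suc_lessThan)
    have leaf: "potential n K (Leaf i) = potential n K (Spine i) + 1"
      by simp
    have N: "N = {Spine (Suc i), Spine j} \<union> (if i \<in> K then {Leaf i} else {})"
      using j i Spine by (auto simp: N_def neighbours_caterpillar_Spine)
    show ?thesis
      using up down leaf crossing_time_Suc[OF fK, of j] j
      by (cases "i \<in> K") (simp_all add: N Spine field_simps del: potential.simps)
  qed
qed

text \<open>The closed set is the whole vertex set; \<open>n \<ge> 2\<close> ensures that every
  spine vertex has a neighbour.\<close>

lemma expected_hitting_time_caterpillar:
  assumes K: "K \<subseteq> {1<..<n}" and i: "1 \<le> i" "i \<le> n" "n \<ge> 2"
  shows "expected_hitting_time (caterpillar n K) (Spine i) (Spine n) =
    ennreal (\<Sum>m = i..<n. crossing_time K m)"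
proof -
  let ?S = "Spine ` {1..n} \<union> Leaf ` K"
  have fK: "finite K" using K by (rule finite_subset) simp
  have nonneg: "0 \<le> (\<Sum>m = j..<n. crossing_time K m)" if "1 \<le> j" for j
    using that by (intro sum_nonneg) (auto simp: crossing_time_def)
  have "expected_hitting_time (caterpillar n K) (Spine i) (Spine n) = ennreal (potential n K (Spine i))"
  proof (rule expected_hitting_time_eqI[where S = ?S])
    fix x assume x: "x \<in> ?S"
    show "0 \<le> potential n K x"
      using x nonneg K by fastforce
    show "finite (neighbours (caterpillar n K) x) \<and> neighbours (caterpillar n K) x \<noteq> {} \<and>
        neighbours (caterpillar n K) x \<subseteq> ?S"
      using x
    proof
      assume "x \<in> Spine ` {1..n}"
      then obtain j where "x = Spine j" "1 \<le> j" "j \<le> n" by auto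
      then show ?thesis
        using \<open>n \<ge> 2\<close> by (auto simp: neighbours_caterpillar_Spine intro!: imageI)
    next
      assume "x \<in> Leaf ` K"
      then show ?thesis using K by (auto simp: neighbours_caterpillar_Leaf image_iff)
    qed
  qed (use fK i K potential_step[OF K] in auto)
  then show ?thesis by simp
qed

section \<open>Closed form of the expected time\<close>

text \<open>Swapping sums, a leaf at \<open>k\<close> is counted once for each \<open>m\<close> from
  \<open>max k i\<close> to \<open>n - 1\<close>. The remaining terms \<open>2 * real m - 1\<close>
  telescope to a difference of squares with a linear correction.\<close>

lemma sum_crossing_time:
  assumes "finite K" "K \<subseteq> {..n}" "i \<le> n"
  shows "(\<Sum>m = i..<n. crossing_time K m) =
    (real n)\<^sup>2 - (real i)\<^sup>2 - 2 * (real n - real i) + 2 * (\<Sum>k\<in>K. real n - real (max k i))"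
proof -
  have count: "(\<Sum>m = i..<n. real (card {k \<in> K. k \<le> m})) = (\<Sum>k\<in>K. real n - real (max k i))"
  proof -
    have "(\<Sum>m = i..<n. real (card {k \<in> K. k \<le> m})) = (\<Sum>m = i..<n. \<Sum>k\<in>K. of_bool (k \<le> m))"
      using assms(1) by (simp add: Int_def)
    also have "\<dots> = (\<Sum>k\<in>K. \<Sum>m = i..<n. of_bool (k \<le> m))"
      by (rule sum.swap)
    also have "\<dots> = (\<Sum>k\<in>K. real n - real (max k i))"
    proof (rule sum.cong)
      fix k assume "k \<in> K"
      have "{i..<n} \<inter> {m. k \<le> m} = {max k i..<n}" by auto
      then show "(\<Sum>m = i..<n. of_bool (k \<le> m)) = real n - real (max k i)"
        using \<open>k \<in> K\<close> assms by (auto simp: of_nat_diff)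
    qed simp
    finally show ?thesis .
  qed
  have "(\<Sum>m = i..<n. 2 * real m - 1) = (real n)\<^sup>2 - (real i)\<^sup>2 - 2 * (real n - real i)"
    using assms(3) by (induction n rule: dec_induct) (simp_all add: power2_eq_square algebra_simps)
  then show ?thesis
    unfolding count[symmetric]
    by (simp add: crossing_time_def sum.distrib sum_distrib_left sum_subtractf algebra_simps)
qed

theorem theorem4:
  fixes n a :: nat and k :: "nat \<Rightarrow> nat"
  assumes "a \<ge> 1"
    and "k 0 = 1"
    and "strict_mono_on {0..a} k"
    and "k a < n"
  shows "(\<forall>s i. s < a \<longrightarrow> k s \<le> i \<longrightarrow> i \<le> k (s + 1) \<longrightarrow>
            expected_hitting_time (caterpillar n (k ` {1..a})) (Spine i) (Spine n) =
              ennreal ((real n)\<^sup>2 - (real i)\<^sup>2 + 2 * (real a - 1) * real n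
                - 2 * (real s - 1) * real i - 2 * (\<Sum>j = s + 1..a. real (k j)))) \<and>
         (\<forall>i. k a \<le> i \<longrightarrow> i \<le> n - 1 \<longrightarrow>
            expected_hitting_time (caterpillar n (k ` {1..a})) (Spine i) (Spine n) =
              ennreal ((real n)\<^sup>2 - (real i)\<^sup>2 + 2 * (real a - 1) * (real n - real i)))"
proof -
  let ?K = "k ` {1..a}"
  have less: "k j < k l" if "j < l" "l \<le> a" for j l
    using strict_mono_onD[OF assms(3), of j l] that by simp
  have le: "k j \<le> k l" if "j \<le> l" "l \<le> a" for j l
    using less[of j l] that by (cases "j = l") auto
  have K: "?K \<subseteq> {1<..<n}"
    using less[of 0] le[of _ a] assms by fastforce
  have inj: "inj_on k {1..a}"
    using strict_mono_on_imp_inj_on[OF assms(3)] by (rule inj_on_subset) auto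
  \<comment> \<open>Admitting \<open>s = a\<close>, where the last sum is empty and the bound by
    \<open>k (s + 1)\<close> disappears, covers both clauses of the theorem with one
    formula.\<close>
  have general: "expected_hitting_time (caterpillar n ?K) (Spine i) (Spine n) =
      ennreal ((real n)\<^sup>2 - (real i)\<^sup>2 + 2 * (real a - 1) * real n
        - 2 * (real s - 1) * real i - 2 * (\<Sum>j = s + 1..a. real (k j)))"
    if s: "s \<le> a" "k s \<le> i" "s < a \<longrightarrow> i \<le> k (s + 1)" "i \<le> n" for s i
  proof -
    have "1 \<le> i" using le[of 0 s] s assms by simp
    \<comment> \<open>Leaves with index up to \<open>s\<close> sit at or before \<open>i\<close>, so
      the maximum is \<open>i\<close>; for the later ones it is \<open>k j\<close>.\<close>
    have split: "{1..a} = {1..s} \<union> {s+1..a}" using s by auto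
    have "(\<Sum>k\<in>?K. real n - real (max k i)) = (\<Sum>j = 1..a. real n - real (max (k j) i))"
      by (subst sum.reindex[OF inj]) simp
    also have "\<dots> = (\<Sum>j = 1..s. real n - real (max (k j) i)) + (\<Sum>j = s+1..a. real n - real (max (k j) i))"
      unfolding split by (rule sum.union_disjoint) auto
    also have "(\<Sum>j = 1..s. real n - real (max (k j) i)) = (\<Sum>j = 1..s. real n - real i)"
      using le[of _ s] s by (intro sum.cong) (fastforce simp: max_def)+
    also have "(\<Sum>j = s+1..a. real n - real (max (k j) i)) = (\<Sum>j = s+1..a. real n - real (k j))"
    proof (rule sum.cong)
      fix j assume "j \<in> {s+1..a}"
      then have "i \<le> k j" using le[of "s + 1" j] s by force
      then show "real n - real (max (k j) i) = real n - real (k j)" by (simp add: max_def)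
    qed simp
    finally have "(\<Sum>k\<in>?K. real n - real (max k i)) =
        real a * real n - real s * real i - (\<Sum>j = s+1..a. real (k j))"
      using s by (simp add: sum_subtractf algebra_simps of_nat_diff)
    moreover have "?K \<subseteq> {..n}" "2 \<le> n"
      using K less[of 0 a] assms by auto
    ultimately have "(\<Sum>m = i..<n. crossing_time ?K m) =
        (real n)\<^sup>2 - (real i)\<^sup>2 + 2 * (real a - 1) * real n
          - 2 * (real s - 1) * real i - 2 * (\<Sum>j = s + 1..a. real (k j))"
      using sum_crossing_time[of ?K n i] \<open>i \<le> n\<close> by (simp add: algebra_simps)
    with \<open>2 \<le> n\<close> show ?thesis
      using expected_hitting_time_caterpillar[OF K \<open>1 \<le> i\<close> \<open>i \<le> n\<close>] by simp
  qed
  show ?thesis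
  proof (intro conjI allI impI)
    fix s i assume "s < a" "k s \<le> i" "i \<le> k (s + 1)"
    then show "expected_hitting_time (caterpillar n ?K) (Spine i) (Spine n) =
      ennreal ((real n)\<^sup>2 - (real i)\<^sup>2 + 2 * (real a - 1) * real n
        - 2 * (real s - 1) * real i - 2 * (\<Sum>j = s + 1..a. real (k j)))"
      \<comment> \<open>The bound \<open>i \<le> n\<close> comes from
        \<open>i \<le> k (s + 1) \<le> k a < n\<close>.\<close>
      using le[of "s + 1" a] assms(4) by (intro general) auto
  next
    fix i assume "k a \<le> i" "i \<le> n - 1"
    then show "expected_hitting_time (caterpillar n ?K) (Spine i) (Spine n) =
      ennreal ((real n)\<^sup>2 - (real i)\<^sup>2 + 2 * (real a - 1) * (real n - real i))"
      using general[of a i] by (simp add: algebra_simps)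
  qed
qed

end
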